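(* Let $\mathcal{G}=(\mathcal{V},\mathcal{E})$ be a connected graph with $\mathcal{V}=\{1,\ldots,n\}$, and let $\{G_{ij}\}_{(i,j)\in\mathcal{E}}$ be a collection of matrices in $GL(d,\mathbb{R})$. Then $\{G_{ij}\}_{(i,j)\in\mathcal{E}}$ is transitively consistent for $\mathcal{G}$ if and only if there is a collection $\{G_i\}_{i\in\mathcal{V}}$ of matrices in $GL(d,\mathbb{R})$ such that $$\mathrm{im}\bigl(U_1(\{G_i\}_{i\in\mathcal{V}})\bigr)=\ker\bigl(H(\mathcal{G},\{G_{ij}\}_{(i,j)\in\mathcal{E}})\bigr).$$ Moreover, such $G_i$ satisfy $G_{ij}=G_i^{-1}G_j$ for all $(i,j)\in\mathcal{E}$.
   Context: $\mathcal{G}=(\mathcal{V},\mathcal{E})$ is a directed graph with node set $\mathcal{V}=\{1,\ldots,n\}$ and edge set $\mathcal{E}\subset\mathcal{V}\times\mathcal{V}$. The graph is connected if there is an undirected path from any node to any other node, i.e. a finite sequence of unique nodes such that for any pair $(i,j)$ of consecutive nodes, $(i,j)\in\mathcal{E}$ or $(j,i)\in\mathcal{E}$. Transitive consistency: a collection $\{G_{ij}\}_{(i,j)\in\mathcal{V}\times\mathcal{V}}$ in $GL(d,\mathbb{R})$ is transitively consistent for the complete graph if $G_{ik}=G_{ij}G_{jk}$ for all $i,j,k$. A collection $\{G_{ij}\}_{(i,j)\in\mathcal{E}}$ in $GL(d,\mathbb{R})$ is transitively consistent for $\mathcal{G}$ if it can be extended to a collection $\{G_{ij}\}_{(i,j)\in\mathcal{V}\times\mathcal{V}}$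 in $GL(d,\mathbb{R})$ that is transitively consistent for the complete graph. For $\{G_i\}_{i\in\mathcal{V}}$ in $GL(d,\mathbb{R})$, $U_1(\{G_i\}_{i\in\mathcal{V}})=[G_1^{-T}\ G_2^{-T}\ \cdots\ G_n^{-T}]^T\in\mathbb{R}^{nd\times d}$, i.e. the vertical stack of $G_1^{-1},\ldots,G_n^{-1}$. The matrix $H$: let $A$ be the adjacency matrix ($A_{ij}=1$ if $(i,j)\in\mathcal{E}$, $0$ otherwise). Let $W(\mathcal{G},\{G_{ij}\})\in\mathbb{R}^{nd\times nd}$ be the block matrix whose $(i,j)$ block of size $d\times d$ is $G_{ij}$ if $(i,j)\in\mathcal{E}$ and $0$ otherwise, and let $Z(\mathcal{G},\{G_{ij}\})=\mathrm{diag}(A\,1_n)\otimes I_d-W(\mathcal{G},\{G_{ij}\})$, with $1_n$ the all-ones vector. Let $\bar{\mathcal{G}}=(\mathcal{V},\bar{\mathcal{E}})$ be $\mathcal{G}$ with all edges reversed and $\bar G_{ij}=G_{ji}^T$ for $(i,j)\in\bar{\mathcal{E}}$. Put $\bar W=W(\bar{\mathcal{G}},\{\bar G_{ij}\}_{(i,j)\in\bar{\mathcal{E}}})$ and $Z_2=\mathrm{diag}(\bar W\bar W^T)-\bar W$, where here $\mathrm{diag}(B)$ keeps the $d\times d$ diagonal blocks of $B\in\mathbb{R}^{nd\times nd}$ and sets all other blocks to zero. Then $H(\mathcal{G},\{G_{ij}\}_{(i,j)\in\mathcal{E}})=Z(\mathcal{G},\{G_{ij}\})+Z_2$. *)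

theory Defs
  imports "HOL-Analysis.Analysis"
begin

text \<open>
  The node set is a finite type \<open>'n\<close> and \<open>d\<close> is the cardinality of a finite type \<open>'d\<close>.
  A directed graph is its edge set \<open>E\<close>. A family indexed by the edges is a function
  \<open>G :: 'n \<Rightarrow> 'n \<Rightarrow> real^'d^'d\<close> whose values outside \<open>E\<close> are irrelevant. Block matrices are
  indexed by pairs (block index, index inside the block); \<open>real^'c^'r\<close> is the type of
  matrices with rows indexed by \<open>'r\<close> and columns by \<open>'c\<close>.
\<close>

definition connected_graph :: "('n \<times> 'n) set \<Rightarrow> bool" where
  "connected_graph E \<longleftrightarrow>
     (\<forall>i j. \<exists>p. p \<noteq> [] \<and> hd p = i \<and> last p = j \<and> distinct p \<and>
        successively (\<lambda>u v. (u, v) \<in> E \<or> (v, u) \<in> E) p)"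

definition transitively_consistent_complete :: "('n \<Rightarrow> 'n \<Rightarrow> real^'d^'d) \<Rightarrow> bool" where
  "transitively_consistent_complete G \<longleftrightarrow> (\<forall>i j k. G i k = G i j ** G j k)"

definition transitively_consistent ::
    "('n \<times> 'n) set \<Rightarrow> ('n \<Rightarrow> 'n \<Rightarrow> real^'d^'d) \<Rightarrow> bool" where
  "transitively_consistent E G \<longleftrightarrow>
     (\<exists>G'. (\<forall>i j. invertible (G' i j)) \<and>
           (\<forall>(i, j)\<in>E. G' i j = G i j) \<and>
           transitively_consistent_complete G')"

definition U1 :: "('n::finite \<Rightarrow> real^'d^'d) \<Rightarrow> real^'d^('n \<times> 'd::finite)" where
  "U1 g = (\<chi> r c. matrix_inv (g (fst r)) $ snd r $ c)"

definition adjacency :: "('n::finite \<times> 'n) set \<Rightarrow> real^'n^'n" where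
  "adjacency E = (\<chi> i j. if (i, j) \<in> E then 1 else 0)"

definition diag_of_vec :: "real^'n \<Rightarrow> real^'n^'n" where
  "diag_of_vec v = (\<chi> i j. if i = j then v $ i else 0)"

definition kronecker ::
    "real^'n^'n \<Rightarrow> real^'d^'d \<Rightarrow> real^('n::finite \<times> 'd::finite)^('n \<times> 'd)" where
  "kronecker A B = (\<chi> r c. A $ fst r $ fst c * B $ snd r $ snd c)"

definition block_diag :: "real^('n::finite \<times> 'd::finite)^('n \<times> 'd) \<Rightarrow> real^('n \<times> 'd)^('n \<times> 'd)" where
  "block_diag B = (\<chi> r c. if fst r = fst c then B $ r $ c else 0)"

definition W_matrix ::
    "('n::finite \<times> 'n) set \<Rightarrow> ('n \<Rightarrow> 'n \<Rightarrow> real^'d^'d) \<Rightarrow> real^('n \<times> 'd::finite)^('n \<times> 'd)" where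
  "W_matrix E G = (\<chi> r c. if (fst r, fst c) \<in> E then G (fst r) (fst c) $ snd r $ snd c else 0)"

text \<open>Here \<open>1\<close> is the all-ones vector of \<open>real^'n\<close>.\<close>

definition Z_matrix ::
    "('n::finite \<times> 'n) set \<Rightarrow> ('n \<Rightarrow> 'n \<Rightarrow> real^'d^'d) \<Rightarrow> real^('n \<times> 'd::finite)^('n \<times> 'd)" where
  "Z_matrix E G = kronecker (diag_of_vec (adjacency E *v 1)) (mat 1) - W_matrix E G"

definition Wbar_matrix ::
    "('n::finite \<times> 'n) set \<Rightarrow> ('n \<Rightarrow> 'n \<Rightarrow> real^'d^'d) \<Rightarrow> real^('n \<times> 'd::finite)^('n \<times> 'd)" where
  "Wbar_matrix E G = W_matrix (E\<inverse>) (\<lambda>i j. transpose (G j i))"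

definition Z2_matrix ::
    "('n::finite \<times> 'n) set \<Rightarrow> ('n \<Rightarrow> 'n \<Rightarrow> real^'d^'d) \<Rightarrow> real^('n \<times> 'd::finite)^('n \<times> 'd)" where
  "Z2_matrix E G =
     block_diag (Wbar_matrix E G ** transpose (Wbar_matrix E G)) - Wbar_matrix E G"

definition H_matrix ::
    "('n::finite \<times> 'n) set \<Rightarrow> ('n \<Rightarrow> 'n \<Rightarrow> real^'d^'d) \<Rightarrow> real^('n \<times> 'd::finite)^('n \<times> 'd)" where
  "H_matrix E G = Z_matrix E G + Z2_matrix E G"

definition matrix_image :: "real^'c^'r \<Rightarrow> (real^'r) set" where
  "matrix_image M = range (\<lambda>x. M *v x)"

definition matrix_kernel :: "real^'c^'r \<Rightarrow> (real^'c) set" where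
  "matrix_kernel M = {x. M *v x = 0}"

end

theory Submission
  imports Defs
begin

text \<open>
  The matrix \<open>H\<close> is the matrix of a positive semidefinite quadratic form that measures by how
  much a stacked vector \<open>x = (x\<^sub>i)\<close> violates the edge equations \<open>x\<^sub>i = G\<^sub>i\<^sub>j x\<^sub>j\<close>. Grouping the terms
  of \<open>Z\<close> and \<open>Z\<^sub>2\<close> by edges, the edge \<open>(i, j)\<close> contributes \<open>x\<^sub>i - G\<^sub>i\<^sub>j x\<^sub>j\<close> to the block \<open>i\<close> of \<open>H x\<close>
  and \<open>- G\<^sub>i\<^sub>j\<^sup>T (x\<^sub>i - G\<^sub>i\<^sub>j x\<^sub>j)\<close> to the block \<open>j\<close>. Pairing with \<open>x\<close> completes the square and gives
  \<open>x \<bullet> H x = (\<Sum>(i, j)\<in>E. \<parallel>x\<^sub>i - G\<^sub>i\<^sub>j x\<^sub>j\<parallel>\<^sup>2)\<close>, so \<open>ker H\<close> is exactly the solution space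
  of the edge equations (lemma \<open>kernel_H_iff\<close>).

  The rest is about these equations alone. The image of \<open>U\<^sub>1\<close> consists of the stacks
  \<open>(g\<^sub>i\<^sup>-\<^sup>1 v)\<close>; all of them solve the edge equations iff \<open>G\<^sub>i\<^sub>j = g\<^sub>i\<^sup>-\<^sup>1 g\<^sub>j\<close> on every edge
  (lemma \<open>image_subset_kernel_iff\<close>), and such a factorization over the edges is the same thing
  as transitive consistency (lemma \<open>transitively_consistent_iff_factorization\<close>). If it
  exists, the edge equations say that \<open>g\<^sub>i x\<^sub>i\<close> takes the same value at both ends of each edge;
  on a connected graph it is a constant \<open>v\<close>, so the solutions are no more than the image of \<open>U\<^sub>1\<close>.
\<close>

section \<open>Blocks of stacked vectors\<close>

definition block :: "real^('n::finite \<times> 'd::finite) \<Rightarrow> 'n \<Rightarrow> real^'d" where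
  "block x i = (\<chi> a. x $ (i, a))"

lemma block_eq_iff: "x = y \<longleftrightarrow> (\<forall>i. block x i = block y i)"
  by (auto simp: block_def vec_eq_iff)

lemma block_linear [simp]:
  "block 0 i = 0"
  "block (x + y) i = block x i + block y i"
  "block (x - y) i = block x i - block y i"
  by (auto simp: block_def vec_eq_iff)

lemma sum_UNIV_prod:
  fixes f :: "'n::finite \<times> 'd::finite \<Rightarrow> 'a::comm_monoid_add"
  shows "(\<Sum>r\<in>UNIV. f r) = (\<Sum>i\<in>UNIV. \<Sum>a\<in>UNIV. f (i, a))"
  by (simp add: sum.cartesian_product UNIV_Times_UNIV[symmetric] del: UNIV_Times_UNIV)

lemma inner_blocks: "x \<bullet> y = (\<Sum>i\<in>UNIV. block x i \<bullet> block y i)"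
  by (simp add: inner_vec_def sum_UNIV_prod block_def)

lemma block_W: "block (W_matrix E G *v x) i = (\<Sum>j | (i, j) \<in> E. G i j *v block x j)"
proof -
  have "block (W_matrix E G *v x) i $ a = (\<Sum>j\<in>UNIV. if (i, j) \<in> E then (G i j *v block x j) $ a else 0)" for a
    unfolding block_def W_matrix_def matrix_vector_mult_def
    by (auto simp: sum_UNIV_prod intro!: sum.cong)
  then show ?thesis
    by (simp add: vec_eq_iff sum.If_cases)
qed

text \<open>The row sums of the adjacency matrix are the out-degrees, so each out-edge of \<open>i\<close> supplies one copy of \<open>x\<^sub>i\<close>.\<close>

lemma block_kronecker_degree:
  "block (kronecker (diag_of_vec (adjacency E *v 1)) (mat 1) *v x) i = (\<Sum>j | (i, j) \<in> E. block x i)"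
proof -
  have delta: "(\<Sum>k\<in>UNIV. \<Sum>b\<in>UNIV. (if i = k then c else 0) * (if a = b then 1 else 0) * x $ (k, b))
      = c * x $ (i, a)" for a and c :: real
  proof -
    have "(\<Sum>k\<in>UNIV. \<Sum>b\<in>UNIV. (if i = k then c else 0) * (if a = b then 1 else 0) * x $ (k, b))
       = (\<Sum>k\<in>UNIV. \<Sum>b\<in>UNIV. if b = a then (if k = i then c * x $ (k, b) else 0) else 0)"
      by (intro sum.cong) auto
    then show ?thesis by simp
  qed
  have "block (kronecker (diag_of_vec (adjacency E *v 1)) (mat 1) *v x) i $ a
     = (adjacency E *v 1) $ i * x $ (i, a)" for a
    unfolding block_def kronecker_def diag_of_vec_def mat_def
    by (subst matrix_vector_mult_def) (simp add: sum_UNIV_prod delta)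
  moreover have "(adjacency E *v 1) $ i = real (card {j. (i, j) \<in> E})"
    by (simp add: matrix_vector_mult_def adjacency_def sum.If_cases)
  ultimately show ?thesis
    by (simp add: vec_eq_iff sum_constant_scaleR block_def del: sum_constant)
qed

lemma block_block_diag_W:
  "block (block_diag (W_matrix E G ** transpose (W_matrix E G)) *v x) i
     = (\<Sum>j | (i, j) \<in> E. G i j *v (transpose (G i j) *v block x i))"
proof -
  let ?M = "W_matrix E G ** transpose (W_matrix E G)"
  have M: "?M $ (i, a) $ (i, b) = (\<Sum>j | (i, j) \<in> E. (G i j ** transpose (G i j)) $ a $ b)" for a b
  proof -
    have "?M $ (i, a) $ (i, b)
        = (\<Sum>j\<in>UNIV. if (i, j) \<in> E then (G i j ** transpose (G i j)) $ a $ b else 0)"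
      unfolding matrix_matrix_mult_def W_matrix_def transpose_def
      by (auto simp: sum_UNIV_prod intro!: sum.cong)
    then show ?thesis by (simp add: sum.If_cases)
  qed
  have "block (block_diag ?M *v x) i $ a
      = (\<Sum>k\<in>UNIV. if i = k then (\<Sum>b\<in>UNIV. ?M $ (i, a) $ (k, b) * x $ (k, b)) else 0)" for a
    unfolding block_def block_diag_def
    by (subst matrix_vector_mult_def, simp only: sum_UNIV_prod vec_lambda_beta fst_conv)
       (rule sum.cong, auto)
  then have "block (block_diag ?M *v x) i $ a
      = (\<Sum>b\<in>UNIV. (\<Sum>j | (i, j) \<in> E. (G i j ** transpose (G i j)) $ a $ b) * x $ (i, b))" for a
    by (simp add: M)
  also have "\<dots> a = (\<Sum>j | (i, j) \<in> E. ((G i j ** transpose (G i j)) *v block x i) $ a)" for a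
    by (simp add: matrix_vector_mult_def sum_distrib_right block_def, rule sum.swap)
  finally show ?thesis
    by (simp add: vec_eq_iff matrix_vector_mul_assoc del: transpose_matrix_vector)
qed

section \<open>The kernel of H\<close>

text \<open>
  In \<open>Z\<close> each edge leaving \<open>i\<close> contributes its residual; \<open>Z\<^sub>2\<close> lives on the reversed graph with
  transposed labels, so each edge entering \<open>i\<close> contributes its residual pulled back along the
  transpose.
\<close>

lemma block_H:
  "block (H_matrix E G *v x) i
     = (\<Sum>j | (i, j) \<in> E. block x i - G i j *v block x j)
       - (\<Sum>j | (j, i) \<in> E. transpose (G j i) *v (block x j - G j i *v block x i))"
  by (simp add: H_matrix_def Z_matrix_def Z2_matrix_def Wbar_matrix_def
      matrix_vector_mult_add_rdistrib matrix_vector_mult_diff_rdistrib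
      block_kronecker_degree block_block_diag_W block_W
      matrix_vector_mult_diff_distrib sum_subtractf)

text \<open>
  Collecting the two contributions of an edge, the factor \<open>G\<^sub>i\<^sub>j\<^sup>T\<close> moves to the other side of
  the inner product, which completes the square.
\<close>

lemma inner_H:
  "x \<bullet> (H_matrix E G *v x) = (\<Sum>(i, j)\<in>E. (norm (block x i - G i j *v block x j))\<^sup>2)"
proof -
  let ?r = "\<lambda>i j. block x i - G i j *v block x j"
  \<comment> \<open>Both ways of summing over the edges, grouped by their source or by their target.\<close>
  have out: "(\<Sum>i\<in>UNIV. \<Sum>j | (i, j) \<in> E. f i j) = (\<Sum>(i, j)\<in>E. f i j)"
    for f :: "'a \<Rightarrow> 'a \<Rightarrow> real"
    by (subst sum.Sigma) (auto intro!: sum.cong)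
  have inc: "(\<Sum>j\<in>UNIV. \<Sum>i | (i, j) \<in> E. f i j) = (\<Sum>(i, j)\<in>E. f i j)"
    for f :: "'a \<Rightarrow> 'a \<Rightarrow> real"
    by (subst sum.Sigma) (auto intro!: sum.reindex_bij_witness[of _ prod.swap prod.swap])
  have split: "v \<bullet> (sum f A - sum h B) = (\<Sum>j\<in>A. v \<bullet> f j) - (\<Sum>j\<in>B. v \<bullet> h j)"
    for v :: "real^'b" and f h :: "'a \<Rightarrow> real^'b" and A B
    by (simp add: inner_diff_right inner_sum_right)
  have adj: "v \<bullet> (transpose A *v w) = (A *v v) \<bullet> w" for A :: "real^'b^'b" and v w
    by (metis dot_lmul_matrix inner_commute transpose_matrix_vector)
  have "x \<bullet> (H_matrix E G *v x)
      = (\<Sum>(i, j)\<in>E. block x i \<bullet> ?r i j)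
        - (\<Sum>(i, j)\<in>E. block x j \<bullet> (transpose (G i j) *v ?r i j))"
    by (simp only: inner_blocks block_H split) (simp only: sum_subtractf out inc)
  also have "\<dots> = (\<Sum>(i, j)\<in>E. block x i \<bullet> ?r i j - (G i j *v block x j) \<bullet> ?r i j)"
    unfolding sum_subtractf[symmetric] adj by (simp only: case_prod_unfold)
  also have "\<dots> = (\<Sum>(i, j)\<in>E. (norm (?r i j))\<^sup>2)"
    by (simp only: power2_norm_eq_inner inner_diff_left)
  finally show ?thesis .
qed

lemma kernel_H_iff:
  "x \<in> matrix_kernel (H_matrix E G) \<longleftrightarrow> (\<forall>(i, j)\<in>E. block x i = G i j *v block x j)"
proof
  assume "x \<in> matrix_kernel (H_matrix E G)"
  then have "(\<Sum>(i, j)\<in>E. (norm (block x i - G i j *v block x j))\<^sup>2) = 0"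
    by (simp add: matrix_kernel_def inner_H[symmetric])
  then show "\<forall>(i, j)\<in>E. block x i = G i j *v block x j"
    by (subst (asm) sum_nonneg_eq_0_iff) (auto simp: case_prod_unfold)
next
  assume "\<forall>(i, j)\<in>E. block x i = G i j *v block x j"
  then have "block x i - G i j *v block x j = 0" if "(i, j) \<in> E" for i j
    using that by auto
  then have "block (H_matrix E G *v x) i = 0" for i
    unfolding block_H by simp
  then show "x \<in> matrix_kernel (H_matrix E G)"
    by (simp add: matrix_kernel_def block_eq_iff)
qed

section \<open>Factorizations over the edges\<close>

lemma matrix_inv_mult:
  fixes A :: "real^'d^'d"
  assumes "invertible A"
  shows "A ** matrix_inv A = mat 1" "matrix_inv A ** A = mat 1"
  using someI_ex[OF assms[unfolded invertible_def]] by (simp_all add: matrix_inv_def)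

lemma invertible_matrix_inv: "invertible A \<Longrightarrow> invertible (matrix_inv A)"
  for A :: "real^'d^'d"
  unfolding invertible_def[of "matrix_inv A"] by (blast intro: matrix_inv_mult)

lemma matrix_eq_mult_inv_iff:
  fixes A B C :: "real^'d^'d"
  assumes "invertible C"
  shows "A = B ** matrix_inv C \<longleftrightarrow> B = A ** C"
proof
  assume "A = B ** matrix_inv C"
  then show "B = A ** C"
    by (simp add: matrix_mul_assoc[symmetric] matrix_inv_mult[OF assms])
next
  assume "B = A ** C"
  then show "A = B ** matrix_inv C"
    by (simp add: matrix_mul_assoc[symmetric] matrix_inv_mult[OF assms])
qed

text \<open>
  A family that is consistent on the complete graph is determined by any one of its rows:
  the row of a base node \<open>k\<close> serves as \<open>g\<close>.
\<close>

lemma transitively_consistent_iff_factorization: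
  fixes G :: "'n \<Rightarrow> 'n \<Rightarrow> real^'d^'d"
  shows "transitively_consistent E G \<longleftrightarrow>
     (\<exists>g :: 'n \<Rightarrow> real^'d^'d. (\<forall>i. invertible (g i)) \<and> (\<forall>(i, j)\<in>E. G i j = matrix_inv (g i) ** g j))"
proof
  assume "transitively_consistent E G"
  then obtain G' where inv: "\<forall>i j. invertible (G' i j)"
    and ext: "\<forall>(i, j)\<in>E. G' i j = G i j"
    and trans: "\<forall>i j k. G' i k = G' i j ** G' j k"
    unfolding transitively_consistent_def transitively_consistent_complete_def by blast
  have "matrix_inv (G' k i) ** G' k j = G' i j" for i j k
  proof -
    have "G' k j = G' k i ** G' i j"
      using trans by blast
    then show ?thesis
      by (simp add: matrix_mul_assoc matrix_inv_mult inv)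
  qed
  with inv ext show "\<exists>g :: 'n \<Rightarrow> real^'d^'d. (\<forall>i. invertible (g i)) \<and> (\<forall>(i, j)\<in>E. G i j = matrix_inv (g i) ** g j)"
    by (intro exI[of _ "G' undefined"]) auto
next
  assume "\<exists>g :: 'n \<Rightarrow> real^'d^'d. (\<forall>i. invertible (g i)) \<and> (\<forall>(i, j)\<in>E. G i j = matrix_inv (g i) ** g j)"
  then obtain g :: "'n \<Rightarrow> real^'d^'d" where inv: "\<forall>i. invertible (g i)"
    and fac: "\<forall>(i, j)\<in>E. G i j = matrix_inv (g i) ** g j" by blast
  have "transitively_consistent_complete (\<lambda>i j. matrix_inv (g i) ** g j)"
    unfolding transitively_consistent_complete_def
  proof (intro allI)
    fix i j k
    have "matrix_inv (g i) ** g j ** (matrix_inv (g j) ** g k)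
        = matrix_inv (g i) ** (g j ** matrix_inv (g j)) ** g k"
      by (simp only: matrix_mul_assoc)
    then show "matrix_inv (g i) ** g k = matrix_inv (g i) ** g j ** (matrix_inv (g j) ** g k)"
      by (simp add: matrix_inv_mult inv)
  qed
  with inv fac show "transitively_consistent E G"
    unfolding transitively_consistent_def
    by (intro exI[of _ "\<lambda>i j. matrix_inv (g i) ** g j"])
       (auto intro: invertible_mult invertible_matrix_inv)
qed

lemma block_U1: "block (U1 g *v v) i = matrix_inv (g i) *v v"
  by (simp add: block_def U1_def matrix_vector_mult_def vec_eq_iff)

text \<open>
  The vector \<open>v\<close> is arbitrary in \<open>g\<^sub>i\<^sup>-\<^sup>1 v = G\<^sub>i\<^sub>j g\<^sub>j\<^sup>-\<^sup>1 v\<close>, so this inclusion already determines the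
  edge labels.
\<close>

lemma image_subset_kernel_iff:
  assumes "\<And>i. invertible (g i)"
  shows "matrix_image (U1 g) \<subseteq> matrix_kernel (H_matrix E G) \<longleftrightarrow>
    (\<forall>(i, j)\<in>E. G i j = matrix_inv (g i) ** g j)"
proof -
  have "matrix_image (U1 g) \<subseteq> matrix_kernel (H_matrix E G) \<longleftrightarrow>
      (\<forall>(i, j)\<in>E. \<forall>v. matrix_inv (g i) *v v = (G i j ** matrix_inv (g j)) *v v)"
    by (auto simp: matrix_image_def image_subset_iff kernel_H_iff block_U1 matrix_vector_mul_assoc)
  also have "\<dots> \<longleftrightarrow> (\<forall>(i, j)\<in>E. matrix_inv (g i) = G i j ** matrix_inv (g j))"
    by (simp add: matrix_eq)
  also have "\<dots> \<longleftrightarrow> (\<forall>(i, j)\<in>E. G i j = matrix_inv (g i) ** g j)"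
    by (simp add: matrix_eq_mult_inv_iff assms)
  finally show ?thesis .
qed

lemma connected_graph_constant:
  assumes "connected_graph E" and edge: "\<And>i j. (i, j) \<in> E \<Longrightarrow> f i = f j"
  shows "f i = f j"
proof -
  have step: "f u = f v" if "(u, v) \<in> E \<or> (v, u) \<in> E" for u v
    using that edge[of u v] edge[of v u] by auto
  have path: "p \<noteq> [] \<Longrightarrow> successively (\<lambda>u v. (u, v) \<in> E \<or> (v, u) \<in> E) p \<Longrightarrow> f (hd p) = f (last p)" for p
  proof (induction p rule: induct_list012)
    case (3 u v p)
    then show ?case using step[of u v] by simp
  qed simp_all
  obtain p where "p \<noteq> []" "hd p = i" "last p = j" "successively (\<lambda>u v. (u, v) \<in> E \<or> (v, u) \<in> E) p"
    using assms(1) unfolding connected_graph_def by blast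
  with path[of p] show ?thesis by simp
qed

text \<open>
  Connectedness is what turns the inclusion into an equality: over a disconnected graph the constant
  \<open>g\<^sub>i x\<^sub>i\<close> could be chosen separately on each component, and the kernel would be larger.
\<close>

lemma image_eq_kernel_iff:
  assumes "connected_graph E" and inv: "\<And>i. invertible (g i)"
  shows "matrix_image (U1 g) = matrix_kernel (H_matrix E G) \<longleftrightarrow>
    (\<forall>(i, j)\<in>E. G i j = matrix_inv (g i) ** g j)"
proof -
  have subset: "matrix_image (U1 g) \<subseteq> matrix_kernel (H_matrix E G) \<longleftrightarrow>
      (\<forall>(i, j)\<in>E. G i j = matrix_inv (g i) ** g j)"
    by (rule image_subset_kernel_iff[OF inv])
  have "x \<in> matrix_image (U1 g)"
    if fac: "\<forall>(i, j)\<in>E. G i j = matrix_inv (g i) ** g j"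
      and "x \<in> matrix_kernel (H_matrix E G)" for x
  proof -
    have solution: "\<forall>(i, j)\<in>E. block x i = G i j *v block x j"
      using that(2) unfolding kernel_H_iff .
    have "g i *v block x i = g j *v block x j" if "(i, j) \<in> E" for i j
    proof -
      have "block x i = (matrix_inv (g i) ** g j) *v block x j"
        using bspec[OF solution that] bspec[OF fac that] by simp
      then show ?thesis
        by (simp add: matrix_vector_mul_assoc matrix_mul_assoc matrix_inv_mult inv)
    qed
    then have const: "g i *v block x i = g j *v block x j" for i j
      by (rule connected_graph_constant[OF assms(1), of "\<lambda>i. g i *v block x i"])
    have "block x i = matrix_inv (g i) *v (g k *v block x k)" for i k
      by (subst const[of k i]) (simp add: matrix_vector_mul_assoc matrix_inv_mult inv)
    \<comment> \<open>Any node can serve as the base node \<open>k\<close>, since \<open>g\<^sub>k x\<^sub>k\<close> is the same everywhere.\<close>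
    then have "x = U1 g *v (g undefined *v block x undefined)"
      unfolding block_eq_iff block_U1 by (rule allI)
    then show ?thesis unfolding matrix_image_def by (rule range_eqI)
  qed
  then have superset: "matrix_kernel (H_matrix E G) \<subseteq> matrix_image (U1 g)"
    if "\<forall>(i, j)\<in>E. G i j = matrix_inv (g i) ** g j"
    using that by (intro subsetI)
  show ?thesis
    unfolding set_eq_subset subset by (rule iffI, erule conjunct1, intro conjI superset)
qed

theorem proposition19:
  fixes E :: "('n::finite \<times> 'n) set"
    and G :: "'n \<Rightarrow> 'n \<Rightarrow> real^'d::finite^'d"
  assumes "connected_graph E"
    and "\<forall>(i, j)\<in>E. invertible (G i j)"
  shows "(transitively_consistent E G \<longleftrightarrow>
            (\<exists>g :: 'n \<Rightarrow> real^'d^'d. (\<forall>i. invertible (g i)) \<and>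
               matrix_image (U1 g) = matrix_kernel (H_matrix E G)))
       \<and> (\<forall>g :: 'n \<Rightarrow> real^'d^'d. (\<forall>i. invertible (g i)) \<and>
               matrix_image (U1 g) = matrix_kernel (H_matrix E G) \<longrightarrow>
            (\<forall>(i, j)\<in>E. G i j = matrix_inv (g i) ** g j))"
proof -
  have "matrix_image (U1 g) = matrix_kernel (H_matrix E G) \<longleftrightarrow>
      (\<forall>(i, j)\<in>E. G i j = matrix_inv (g i) ** g j)"
    if "\<forall>i. invertible (g i)" for g :: "'n \<Rightarrow> real^'d^'d"
    using image_eq_kernel_iff[OF assms(1)] that by blast
  then show ?thesis
    unfolding transitively_consistent_iff_factorization by blast
qed

end
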